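(* Let $x>0$, $x\neq1$, and let $n$ and $k\ge 1$ be integers with $2k\le n-1$. Let $\mathbf{A}$ be a circulant reciprocal $n\times n$ matrix each of whose rows contains exactly $k$ entries equal to $x$, exactly $k$ entries equal to $1/x$, and $n-2k$ entries equal to $1$. Then the Perron root of $\mathbf{A}$ is $$\lambda_{\max}=n+k\,\frac{(x-1)^2}{x},$$ with corresponding eigenvector $(1,1,\dots,1)^T$, and $$CI(\mathbf{A})=\frac{k}{n-1}\cdot\frac{(x-1)^2}{x}.$$
   Context: A square matrix $\mathbf{A}=(a_{ij})$ with positive entries is reciprocal if $a_{ij}=1/a_{ji}$ for all $i,j$ (in particular $a_{ii}=1$). An $n\times n$ matrix is circulant if there are constants $c_0,\dots,c_{n-1}$ such that $a_{ij}=c_{(j-i)\bmod n}$, i.e. each row is the cyclic shift by one position to the right of the row above it. The Perron root $\lambda_{\max}$ of a square matrix with positive entries is its spectral radius (which is an eigenvalue). For an $n\times n$ positive reciprocal matrix $\mathbf{A}$, the consistency index is $CI(\mathbf{A})=\dfrac{\lambda_{\max}(\mathbf{A})-n}{n-1}$. *)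

theory Defs
  imports "Jordan_Normal_Form.Spectral_Radius"
begin

definition reciprocal_mat :: "real mat \<Rightarrow> bool" where
  "reciprocal_mat A \<longleftrightarrow> square_mat A \<and>
     (\<forall>i<dim_row A. \<forall>j<dim_row A. A $$ (i, j) > 0 \<and> A $$ (i, j) = 1 / A $$ (j, i))"

text \<open>The difference \<open>j - i\<close> is taken in the integers, since subtraction on naturals truncates.\<close>

definition circulant_mat :: "'a mat \<Rightarrow> bool" where
  "circulant_mat A \<longleftrightarrow> square_mat A \<and>
     (\<exists>c :: nat \<Rightarrow> 'a. \<forall>i<dim_row A. \<forall>j<dim_row A.
        A $$ (i, j) = c (nat ((int j - int i) mod int (dim_row A))))"

text \<open>The spectral radius ranges over all complex eigenvalues, so the real matrix is embedded
  into the complex matrices.\<close>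

definition perron_root :: "real mat \<Rightarrow> real" where
  "perron_root A = spectral_radius (map_mat complex_of_real A)"

definition consistency_index :: "real mat \<Rightarrow> real" where
  "consistency_index A = (perron_root A - real (dim_row A)) / (real (dim_row A) - 1)"

end

theory Submission
  imports Defs
begin

text \<open>
  All rows of \<open>A\<close> have the same sum \<open>s = k * x + k / x + (n - 2 * k) = n + k * (x - 1)\<^sup>2 / x\<close>, because
  \<open>x\<close>, \<open>1 / x\<close> and \<open>1\<close> are three different numbers and the given multiplicities add up to \<open>n\<close>, which
  leaves no room for a fourth value in a row. Constant row sums mean exactly that the all-ones vector
  is an eigenvector for \<open>s\<close>. Since the entries are nonnegative, \<open>s\<close> is also the maximal absolute row
  sum, which bounds the modulus of every eigenvalue (\<open>eigenvalue_norm_le_row_sum\<close>). Hence \<open>s\<close> is the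
  spectral radius (\<open>perron_root_constant_row_sum\<close>), and the consistency index follows.
\<close>

lemma mult_ones_vec_row_sum:
  fixes A :: "'a :: semiring_1 mat"
  assumes "A \<in> carrier_mat n n"
    and "\<And>i. i < n \<Longrightarrow> (\<Sum>j<n. A $$ (i, j)) = s"
  shows "A *\<^sub>v vec n (\<lambda>_. 1) = s \<cdot>\<^sub>v vec n (\<lambda>_. 1)"
  using assms by (intro eq_vecI) (auto simp: scalar_prod_def atLeast0LessThan)

lemma eigenvector_ones_row_sum:
  fixes A :: "'a :: comm_ring_1 mat"
  assumes "A \<in> carrier_mat n n" and "n > 0"
    and "\<And>i. i < n \<Longrightarrow> (\<Sum>j<n. A $$ (i, j)) = s"
  shows "eigenvector A (vec n (\<lambda>_. 1)) s"
proof -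
  have "vec n (\<lambda>_. 1 :: 'a) $ 0 \<noteq> 0\<^sub>v n $ 0"
    using assms(2) by simp
  then have "vec n (\<lambda>_. 1 :: 'a) \<noteq> 0\<^sub>v n"
    by metis
  then show ?thesis
    using assms(1) mult_ones_vec_row_sum[OF assms(1,3)] unfolding eigenvector_def by auto
qed

text \<open>
  In a coordinate where an eigenvector \<open>v\<close> has largest modulus \<open>m\<close>, the triangle inequality applied to
  \<open>A v = \<mu> v\<close> gives \<open>|\<mu>| m \<le> s m\<close>.
\<close>

lemma eigenvalue_norm_le_row_sum:
  fixes A :: "'a :: real_normed_field mat"
  assumes A: "A \<in> carrier_mat n n"
    and row: "\<And>i. i < n \<Longrightarrow> (\<Sum>j<n. norm (A $$ (i, j))) \<le> s"
    and ev: "eigenvalue A \<mu>"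
  shows "norm \<mu> \<le> s"
proof -
  from ev A obtain v where v: "v \<in> carrier_vec n" "v \<noteq> 0\<^sub>v n" "A *\<^sub>v v = \<mu> \<cdot>\<^sub>v v"
    unfolding eigenvalue_def eigenvector_def by auto
  obtain l where l: "l < n" "v $ l \<noteq> 0"
    using v(1,2) by (metis carrier_vecD eq_vecI index_zero_vec)
  define m where "m = Max ((\<lambda>j. norm (v $ j)) ` {..<n})"
  have m_ge: "norm (v $ j) \<le> m" if "j < n" for j
    unfolding m_def using that by (intro Max_ge) auto
  have "m \<in> (\<lambda>j. norm (v $ j)) ` {..<n}"
    unfolding m_def using l(1) by (intro Max_in) auto
  then obtain i where i: "i < n" "norm (v $ i) = m"
    by auto
  have m_pos: "m > 0"
    using m_ge[OF l(1)] l(2) by (meson less_le_trans zero_less_norm_iff)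
  have "\<mu> * v $ i = (A *\<^sub>v v) $ i"
    using v i(1) by simp
  also have "\<dots> = (\<Sum>j<n. A $$ (i, j) * v $ j)"
    using A v(1) i(1) by (auto simp: scalar_prod_def atLeast0LessThan)
  finally have "norm \<mu> * m = norm (\<Sum>j<n. A $$ (i, j) * v $ j)"
    using i(2) by (metis norm_mult)
  also have "\<dots> \<le> (\<Sum>j<n. norm (A $$ (i, j)) * m)"
    by (intro sum_norm_le) (auto simp: norm_mult intro!: mult_left_mono m_ge)
  also have "\<dots> \<le> s * m"
    using row[OF i(1)] m_pos by (simp flip: sum_distrib_right)
  finally show ?thesis
    using m_pos by simp
qed

lemma perron_root_constant_row_sum:
  assumes A: "A \<in> carrier_mat n n" and n: "n > 0"
    and nonneg: "\<And>i j. i < n \<Longrightarrow> j < n \<Longrightarrow> A $$ (i, j) \<ge> 0"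
    and row: "\<And>i. i < n \<Longrightarrow> (\<Sum>j<n. A $$ (i, j)) = s"
  shows "perron_root A = s"
proof -
  let ?B = "map_mat complex_of_real A"
  have B: "?B \<in> carrier_mat n n"
    using A by simp
  have entry: "?B $$ (i, j) = complex_of_real (A $$ (i, j))" if "i < n" "j < n" for i j
    using A that by simp
  have s: "s \<ge> 0"
    using row[OF n] nonneg[OF n] by (metis lessThan_iff sum_nonneg)
  have "(\<Sum>j<n. ?B $$ (i, j)) = complex_of_real s" if "i < n" for i
    using row[OF that] entry[OF that] by (simp flip: of_real_sum)
  then have "eigenvector ?B (vec n (\<lambda>_. 1)) (complex_of_real s)"
    by (intro eigenvector_ones_row_sum B n)
  then have "eigenvalue ?B (complex_of_real s)"
    unfolding eigenvalue_def by blast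
  then have "cmod (complex_of_real s) \<le> spectral_radius ?B"
    by (intro spectral_radius_mem_max(2)[OF B n] imageI) (simp add: spectrum_def)
  then have lower: "s \<le> spectral_radius ?B"
    using s by simp
  obtain \<mu> where \<mu>: "eigenvalue ?B \<mu>" "spectral_radius ?B = cmod \<mu>"
    using spectral_radius_mem_max(1)[OF B n] by (auto simp: spectrum_def)
  have "(\<Sum>j<n. cmod (?B $$ (i, j))) \<le> s" if "i < n" for i
    using row[OF that] entry[OF that] nonneg[OF that] by simp
  then have "cmod \<mu> \<le> s"
    using eigenvalue_norm_le_row_sum[OF B _ \<mu>(1)] by blast
  with lower \<mu>(2) show ?thesis
    unfolding perron_root_def by simp
qed

text \<open>
  Three disjoint level sets whose sizes add up to \<open>card S\<close> exhaust \<open>S\<close>, so the counts alone determine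
  the sum.
\<close>

lemma sum_three_values:
  fixes f :: "'b \<Rightarrow> 'a :: semiring_1"
  assumes fin: "finite S" and distinct: "a \<noteq> b" "a \<noteq> c" "b \<noteq> c"
    and ca: "card {j \<in> S. f j = a} = p"
    and cb: "card {j \<in> S. f j = b} = q"
    and cc: "card {j \<in> S. f j = c} = r"
    and total: "p + q + r = card S"
  shows "sum f S = of_nat p * a + of_nat q * b + of_nat r * c"
proof -
  let ?L = "\<lambda>y. {j \<in> S. f j = y}"
  have fin': "finite (?L y)" for y
    using fin by simp
  have disj: "?L a \<inter> ?L b = {}" "(?L a \<union> ?L b) \<inter> ?L c = {}"
    using distinct by auto
  have "card (?L a \<union> ?L b \<union> ?L c) = card S"
    using fin' disj ca cb cc total by (simp add: card_Un_disjoint)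
  then have "?L a \<union> ?L b \<union> ?L c = S"
    by (intro card_subset_eq fin) auto
  then have "sum f S = sum f (?L a \<union> ?L b \<union> ?L c)"
    by simp
  also have "\<dots> = sum f (?L a) + sum f (?L b) + sum f (?L c)"
    using fin' disj by (simp add: sum.union_disjoint)
  also have "sum f (?L a) = of_nat p * a"
    using ca by simp
  also have "sum f (?L b) = of_nat q * b"
    using cb by simp
  also have "sum f (?L c) = of_nat r * c"
    using cc by simp
  finally show ?thesis .
qed

theorem mainTheorem4:
  fixes x :: real and n k :: nat and A :: "real mat"
  assumes "x > 0" and "x \<noteq> 1"
    and "k \<ge> 1" and "2 * k \<le> n - 1"
    and "A \<in> carrier_mat n n"
    and "circulant_mat A" and "reciprocal_mat A"
    and "\<And>i. i < n \<Longrightarrow> card {j. j < n \<and> A $$ (i, j) = x} = k"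
    and "\<And>i. i < n \<Longrightarrow> card {j. j < n \<and> A $$ (i, j) = 1 / x} = k"
    and "\<And>i. i < n \<Longrightarrow> card {j. j < n \<and> A $$ (i, j) = 1} = n - 2 * k"
  shows "perron_root A = real n + real k * ((x - 1)\<^sup>2 / x)
    \<and> eigenvector A (vec n (\<lambda>_. 1)) (perron_root A)
    \<and> consistency_index A = real k / (real n - 1) * ((x - 1)\<^sup>2 / x)"
proof -
  let ?s = "real n + real k * ((x - 1)\<^sup>2 / x)"
  have n: "n > 0" "2 * k \<le> n"
    using assms(3,4) by auto
  have "x\<^sup>2 \<noteq> 1"
    using assms(1,2) by (auto simp: power2_eq_1_iff)
  then have distinct: "x \<noteq> 1 / x" "1 / x \<noteq> 1"
    using assms(1,2) by (auto simp: field_simps power2_eq_square)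
  have row: "(\<Sum>j<n. A $$ (i, j)) = ?s" if i: "i < n" for i
  proof -
    have "(\<Sum>j<n. A $$ (i, j)) = real k * x + real k * (1 / x) + real (n - 2 * k) * 1"
      by (rule sum_three_values) (use n(2) distinct assms(2,8-10) i in auto)
    also have "\<dots> = ?s"
      using n(2) assms(1) by (simp add: field_simps power2_eq_square)
    finally show ?thesis .
  qed
  have nonneg: "A $$ (i, j) \<ge> 0" if "i < n" "j < n" for i j
    using assms(5,7) that unfolding reciprocal_mat_def by (metis carrier_matD(1) less_imp_le)
  have root: "perron_root A = ?s"
    by (rule perron_root_constant_row_sum[OF assms(5) n(1) nonneg row])
  have "eigenvector A (vec n (\<lambda>_. 1)) (perron_root A)"
    unfolding root by (rule eigenvector_ones_row_sum[OF assms(5) n(1) row])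
  moreover have "consistency_index A = real k / (real n - 1) * ((x - 1)\<^sup>2 / x)"
    unfolding consistency_index_def root using assms(5) by simp
  ultimately show ?thesis
    using root by blast
qed

end
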